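(* The Eigenvector Method may violate group-coherence for choice even if $n = 4$, but four is the minimal number of alternatives for this: the ranking method $\mathbf{A} \mapsto \succeq^{EM}_{\mathbf{A}}$ on $\mathcal{A}^{n \times n}$ does not satisfy group-coherence for choice for $n = 4$, and it satisfies group-coherence for choice for every $n \leq 3$.
   Context: A pairwise comparison matrix of size $n \times n$ is a matrix $\mathbf{A} = [a_{ij}]$ with all entries positive reals such that $a_{ji} = 1/a_{ij}$ for all $1 \leq i,j \leq n$; $\mathcal{A}^{n \times n}$ denotes the set of all of them. The indices $1,\dots,n$ are called alternatives. Eigenvector Method ($EM$): for $\mathbf{A} \in \mathcal{A}^{n \times n}$, $\mathbf{w}^{EM}(\mathbf{A})$ is the vector with positive entries summing to $1$ such that $\mathbf{A}\mathbf{w}^{EM}(\mathbf{A}) = \lambda_{\max}(\mathbf{A}) \mathbf{w}^{EM}(\mathbf{A})$, where $\lambda_{\max}(\mathbf{A})$ is the maximal (Perron) eigenvalue of $\mathbf{A}$. A ranking of the alternatives is a complete, reflexive and transitive binary relation $\succeq$ on $\{1,\dots,n\}$; its strict part is $i \succ j$ iff $i \succeq j$ and not $j \succeq i$. A ranking method $g$ assigns to each $\mathbf{A} \in \mathcal{A}^{n \times n}$ a ranking $\succeq^g_{\mathbf{A}}$. The ranking method induced by $EM$ is defined by $i \succeq^{EM}_{\mathbf{A}} j$ iff $w^{EM}_i(\mathbf{A}) \geq w^{EM}_j(\mathbf{A})$. Aggregation: for $\mathbf{A}^{(1)},\dots,\mathbf{A}^{(k)} \in \mathcal{A}^{n \times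 n}$, $\mathbf{A}^{(1)} \oplus \dots \oplus \mathbf{A}^{(k)} \in \mathcal{A}^{n \times n}$ is the entrywise geometric mean, with $(i,j)$ entry $\sqrt[k]{a^{(1)}_{ij} a^{(2)}_{ij} \cdots a^{(k)}_{ij}}$. Group-coherence for choice ($GCC$): a ranking method $g$ on $\mathcal{A}^{n \times n}$ satisfies $GCC$ if for all $k \geq 1$, all $\mathbf{A}^{(1)},\dots,\mathbf{A}^{(k)} \in \mathcal{A}^{n \times n}$ and every alternative $i$ such that $i \succeq^g_{\mathbf{A}^{(\ell)}} j$ for all $1 \leq j \leq n$ and $1 \leq \ell \leq k$, one has $i \succeq^g_{\mathbf{A}^{(1)} \oplus \dots \oplus \mathbf{A}^{(k)}} j$ for all $1 \leq j \leq n$; and furthermore, if there is at least one $\ell$ with $i \succ^g_{\mathbf{A}^{(\ell)}} j$ for all $j \neq i$, then $i \succ^g_{\mathbf{A}^{(1)} \oplus \dots \oplus \mathbf{A}^{(k)}} j$ for all $j \neq i$. *)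

theory Defs
  imports "Jordan_Normal_Form.Spectral_Radius"
begin

text \<open>The alternatives of an \<open>n \<times> n\<close> matrix are the indices \<open>0, \<dots>, n - 1\<close>.\<close>

definition pairwise_comparison_matrices :: "nat \<Rightarrow> real mat set" where
  "pairwise_comparison_matrices n =
    {A \<in> carrier_mat n n.
      (\<forall>i<n. \<forall>j<n. 0 < A $$ (i, j) \<and> A $$ (j, i) = 1 / A $$ (i, j))}"

text \<open>The spectrum of a real matrix consists of its real eigenvalues; for a matrix with positive
  entries the largest of them is the Perron eigenvalue.\<close>

definition lambda_max :: "real mat \<Rightarrow> real" where
  "lambda_max A = Max (spectrum A)"

definition em_weight :: "real mat \<Rightarrow> real vec" where
  "em_weight A = (THE w. w \<in> carrier_vec (dim_row A) \<and>
    (\<forall>i<dim_row A. 0 < w $ i) \<and>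
    (\<Sum>i<dim_row A. w $ i) = 1 \<and>
    A *\<^sub>v w = lambda_max A \<cdot>\<^sub>v w)"

definition ranking :: "nat \<Rightarrow> (nat \<Rightarrow> nat \<Rightarrow> bool) \<Rightarrow> bool" where
  "ranking n r \<longleftrightarrow> totalp_on {..<n} r \<and> reflp_on {..<n} r \<and> transp_on {..<n} r"

definition strict_part :: "(nat \<Rightarrow> nat \<Rightarrow> bool) \<Rightarrow> nat \<Rightarrow> nat \<Rightarrow> bool" where
  "strict_part r i j \<longleftrightarrow> r i j \<and> \<not> r j i"

definition ranking_method :: "nat \<Rightarrow> (real mat \<Rightarrow> nat \<Rightarrow> nat \<Rightarrow> bool) \<Rightarrow> bool" where
  "ranking_method n g \<longleftrightarrow> (\<forall>A\<in>pairwise_comparison_matrices n. ranking n (g A))"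

definition em_ranking :: "real mat \<Rightarrow> nat \<Rightarrow> nat \<Rightarrow> bool" where
  "em_ranking A i j \<longleftrightarrow> em_weight A $ i \<ge> em_weight A $ j"

lemma ranking_method_em_ranking: "ranking_method n em_ranking"
  by (auto simp: ranking_method_def ranking_def em_ranking_def
      intro!: totalp_onI reflp_onI transp_onI)

definition aggregate :: "nat \<Rightarrow> nat \<Rightarrow> (nat \<Rightarrow> real mat) \<Rightarrow> real mat" where
  "aggregate n k A = mat n n (\<lambda>(i, j). root k (\<Prod>l=1..k. A l $$ (i, j)))"

lemma aggregate_pairwise_comparison_matrices:
  assumes "k \<ge> 1" "\<And>l. l \<in> {1..k} \<Longrightarrow> A l \<in> pairwise_comparison_matrices n"
  shows "aggregate n k A \<in> pairwise_comparison_matrices n"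
proof -
  have pos: "0 < (\<Prod>l=1..k. A l $$ (i, j))" if "i < n" "j < n" for i j
    using assms(2) that unfolding pairwise_comparison_matrices_def by (intro prod_pos) blast
  have inv: "(\<Prod>l=1..k. A l $$ (j, i)) = 1 / (\<Prod>l=1..k. A l $$ (i, j))"
    if "i < n" "j < n" for i j
  proof -
    have "A l $$ (j, i) = 1 / A l $$ (i, j)" if "l \<in> {1..k}" for l
      using assms(2)[OF that] \<open>i < n\<close> \<open>j < n\<close>
      unfolding pairwise_comparison_matrices_def by blast
    then have "(\<Prod>l=1..k. A l $$ (j, i)) = (\<Prod>l=1..k. 1 / A l $$ (i, j))"
      by (intro prod.cong refl)
    then show ?thesis by (simp only: prod_dividef prod.neutral_const)
  qed
  have "0 < aggregate n k A $$ (i, j) \<and>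
      aggregate n k A $$ (j, i) = 1 / aggregate n k A $$ (i, j)" if "i < n" "j < n" for i j
  proof -
    have "root k (\<Prod>l=1..k. A l $$ (j, i)) = 1 / root k (\<Prod>l=1..k. A l $$ (i, j))"
      unfolding inv[OF that] using assms(1) by (simp add: real_root_divide)
    moreover have "0 < root k (\<Prod>l=1..k. A l $$ (i, j))"
      using pos[OF that] assms(1) by (simp add: real_root_gt_zero)
    ultimately show ?thesis using that by (simp add: aggregate_def)
  qed
  moreover have "aggregate n k A \<in> carrier_mat n n"
    by (simp add: aggregate_def)
  ultimately show ?thesis
    unfolding pairwise_comparison_matrices_def by blast
qed

definition group_coherence_for_choice ::
    "nat \<Rightarrow> (real mat \<Rightarrow> nat \<Rightarrow> nat \<Rightarrow> bool) \<Rightarrow> bool" where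
  "group_coherence_for_choice n g \<longleftrightarrow>
    (\<forall>k\<ge>1. \<forall>A. (\<forall>l\<in>{1..k}. A l \<in> pairwise_comparison_matrices n) \<longrightarrow>
      (\<forall>i<n. (\<forall>l\<in>{1..k}. \<forall>j<n. g (A l) i j) \<longrightarrow>
        (\<forall>j<n. g (aggregate n k A) i j) \<and>
        ((\<exists>l\<in>{1..k}. \<forall>j<n. j \<noteq> i \<longrightarrow> strict_part (g (A l)) i j) \<longrightarrow>
          (\<forall>j<n. j \<noteq> i \<longrightarrow> strict_part (g (aggregate n k A)) i j))))"

end

theory Submission
  imports Defs
begin

text \<open>
  A positive eigenvector \<open>u\<close> of an entrywise positive matrix always belongs to the maximal
  eigenvalue and is unique up to scaling (\<open>positive_eigenvector_max\<close>,
  \<open>positive_eigenvector_unique\<close>). Hence exhibiting such a \<open>u\<close> determines the ranking of the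
  Eigenvector Method, see \<open>em_ranking_iff\<close>, and in all relevant cases the eigenvector can be
  written down.

  For at most three alternatives the geometric means of the rows form such an eigenvector, so that
  alternatives are ranked by the products of their rows (\<open>em_ranking_iff_row_product\<close>). The
  row products of an aggregated matrix are the geometric means of the individual row products, and
  a geometric mean is monotone, and strictly so in each argument. This gives group-coherence.

  For four alternatives, take a directed Hamiltonian cycle on the alternatives and let every
  alternative be preferred to its successor by the factor 8, all other comparisons being 1. All row
  sums of this matrix are equal, so all four alternatives are tied. Aggregate three such matrices,
  obtained from each other by rotating the alternatives 1, 2, 3 while fixing 0. The comparisons
  with 0 cancel, whereas those among 1, 2, 3 accumulate to a 3-cycle. The row sums of the aggregate
  are 4 in row 0 and \<open>1 + 1 + 4 + 1/4\<close> in the others; its Perron vector \<open>(1, y, y, y)\<close> therefore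
  has \<open>y > 1\<close>, and alternative 0, although a best one in each of the three matrices,
  is not a best one any more.
\<close>

section \<open>Positive eigenvectors of positive matrices\<close>

text \<open>Scaling by the positive eigenvector \<open>u\<close> turns the matrix into a nonnegative one with constant
  row sums \<open>m\<close>. The eigenvalue equation for \<open>v\<close> is read off at an index maximizing
  \<open>\<bar>v j\<bar> / u j\<close>.\<close>

lemma positive_eigenvector_max:
  fixes a :: "nat \<Rightarrow> nat \<Rightarrow> real"
  assumes a: "\<And>i j. i < n \<Longrightarrow> j < n \<Longrightarrow> 0 \<le> a i j"
    and u: "\<And>i. i < n \<Longrightarrow> 0 < u i"
    and eu: "\<And>i. i < n \<Longrightarrow> (\<Sum>j<n. a i j * u j) = m * u i"
    and ev: "\<And>i. i < n \<Longrightarrow> (\<Sum>j<n. a i j * v j) = k * v i"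
    and nz: "l < n" "v l \<noteq> 0"
  shows "k \<le> m"
proof -
  have "Max ((\<lambda>j. \<bar>v j\<bar> / u j) ` {..<n}) \<in> (\<lambda>j. \<bar>v j\<bar> / u j) ` {..<n}"
    using nz(1) by (intro Max_in) auto
  then obtain i where i: "i < n" "Max ((\<lambda>j. \<bar>v j\<bar> / u j) ` {..<n}) = \<bar>v i\<bar> / u i"
    by auto
  define c where "c = \<bar>v i\<bar> / u i"
  have le: "\<bar>v j\<bar> \<le> c * u j" if "j < n" for j
  proof -
    have "\<bar>v j\<bar> / u j \<le> c"
      unfolding c_def i(2)[symmetric] using that by (intro Max_ge) auto
    then show ?thesis using u[OF that] by (simp add: divide_le_eq)
  qed
  have vi: "\<bar>v i\<bar> = c * u i" using u[OF i(1)] by (simp add: c_def)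
  have c: "0 < c"
  proof -
    have "0 < c * u l" using le[OF nz(1)] nz(2) by linarith
    then show ?thesis using u[OF nz(1)] by (simp add: zero_less_mult_iff)
  qed
  have "k * \<bar>v i\<bar> \<le> \<bar>k * v i\<bar>" by (simp add: abs_mult mult_right_mono)
  also have "\<dots> = \<bar>\<Sum>j<n. a i j * v j\<bar>" using ev[OF i(1)] by simp
  also have "\<dots> \<le> (\<Sum>j<n. \<bar>a i j * v j\<bar>)" by (rule sum_abs)
  also have "\<dots> \<le> (\<Sum>j<n. a i j * (c * u j))"
    using a[OF i(1)] le by (intro sum_mono) (auto simp: abs_mult intro!: mult_left_mono)
  also have "\<dots> = c * (\<Sum>j<n. a i j * u j)" by (simp add: sum_distrib_left mult_ac)
  also have "\<dots> = m * \<bar>v i\<bar>" using eu[OF i(1)] vi by simp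
  finally show ?thesis using c vi u[OF i(1)] by simp
qed

text \<open>If \<open>c\<close> is the smallest ratio \<open>v j / u j\<close>, then \<open>v - c u\<close> is a nonnegative eigenvector or
  zero, and it vanishes at some index; positivity of that row makes it vanish everywhere.\<close>

lemma positive_eigenvector_unique:
  fixes a :: "nat \<Rightarrow> nat \<Rightarrow> real"
  assumes a: "\<And>i j. i < n \<Longrightarrow> j < n \<Longrightarrow> 0 < a i j"
    and u: "\<And>i. i < n \<Longrightarrow> 0 < u i"
    and eu: "\<And>i. i < n \<Longrightarrow> (\<Sum>j<n. a i j * u j) = m * u i"
    and ev: "\<And>i. i < n \<Longrightarrow> (\<Sum>j<n. a i j * v j) = m * v i"
  shows "\<exists>c. \<forall>j<n. v j = c * u j"
proof (cases "n = 0")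
  case False
  have "Min ((\<lambda>j. v j / u j) ` {..<n}) \<in> (\<lambda>j. v j / u j) ` {..<n}"
    using False by (intro Min_in) auto
  then obtain i where i: "i < n" "Min ((\<lambda>j. v j / u j) ` {..<n}) = v i / u i"
    by auto
  define c where "c = v i / u i"
  have le: "c * u j \<le> v j" if "j < n" for j
  proof -
    have "c \<le> v j / u j"
      unfolding c_def i(2)[symmetric] using that by (intro Min_le) auto
    then show ?thesis using u[OF that] by (simp add: le_divide_eq)
  qed
  have vi: "v i = c * u i" using u[OF i(1)] by (simp add: c_def)
  have "(\<Sum>j<n. a i j * (v j - c * u j)) = (\<Sum>j<n. a i j * v j) - c * (\<Sum>j<n. a i j * u j)"
    by (simp add: algebra_simps sum_subtractf sum_distrib_left)
  also have "\<dots> = 0" using eu[OF i(1)] ev[OF i(1)] vi by simp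
  finally have "\<forall>j\<in>{..<n}. a i j * (v j - c * u j) = 0"
    using a[OF i(1)] le
    by (subst (asm) sum_nonneg_eq_0_iff) (simp_all add: less_imp_le)
  then have "a i j * (v j - c * u j) = 0" if "j < n" for j
    using that by blast
  then have "v j = c * u j" if "j < n" for j
    using a[OF i(1) that] that by (metis less_irrefl mult_eq_0_iff right_minus_eq)
  then show ?thesis by blast
qed auto

lemma mult_mat_vec_index_sum:
  assumes "A \<in> carrier_mat n n" "v \<in> carrier_vec n" "i < n"
  shows "(A *\<^sub>v v) $ i = (\<Sum>j<n. A $$ (i, j) * v $ j)"
  using assms by (auto simp: scalar_prod_def lessThan_atLeast0 intro!: sum.cong)

lemma eigen_equation_index:
  assumes "A \<in> carrier_mat n n" "v \<in> carrier_vec n" "A *\<^sub>v v = m \<cdot>\<^sub>v v" "i < n"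
  shows "(\<Sum>j<n. A $$ (i, j) * v $ j) = m * v $ i"
  using mult_mat_vec_index_sum[OF assms(1,2,4)] assms by simp

lemma lambda_max_eq:
  assumes A: "A \<in> carrier_mat n n"
    and a: "\<And>i j. i < n \<Longrightarrow> j < n \<Longrightarrow> 0 < A $$ (i, j)"
    and w: "w \<in> carrier_vec n" "\<And>i. i < n \<Longrightarrow> 0 < w $ i" "A *\<^sub>v w = m \<cdot>\<^sub>v w"
    and n: "0 < n"
  shows "lambda_max A = m"
  unfolding lambda_max_def
proof (rule Max_eqI)
  show "finite (spectrum A)" by (rule card_finite_spectrum[OF A])
  have "w \<noteq> 0\<^sub>v n" using w(2)[OF n] n by auto
  then show "m \<in> spectrum A"
    using A w unfolding spectrum_def eigenvalue_def eigenvector_def by auto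
  fix k assume "k \<in> spectrum A"
  then obtain v where v: "v \<in> carrier_vec n" "v \<noteq> 0\<^sub>v n" "A *\<^sub>v v = k \<cdot>\<^sub>v v"
    using A unfolding spectrum_def eigenvalue_def eigenvector_def by auto
  then have "\<exists>l<n. v $ l \<noteq> 0" by (metis eq_vecI carrier_vecD index_zero_vec)
  then obtain l where l: "l < n" "v $ l \<noteq> 0" by blast
  show "k \<le> m"
    by (rule positive_eigenvector_max[where a = "\<lambda>i j. A $$ (i, j)" and u = "($) w"
          and v = "($) v" and n = n])
      (use a w(2) l eigen_equation_index[OF A w(1,3)] eigen_equation_index[OF A v(1,3)] in
        \<open>auto intro: less_imp_le\<close>)
qed

lemma em_weight_eq:
  assumes A: "A \<in> carrier_mat n n"
    and a: "\<And>i j. i < n \<Longrightarrow> j < n \<Longrightarrow> 0 < A $$ (i, j)"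
    and w: "w \<in> carrier_vec n" "\<And>i. i < n \<Longrightarrow> 0 < w $ i" "A *\<^sub>v w = m \<cdot>\<^sub>v w"
    and sum: "(\<Sum>i<n. w $ i) = 1"
  shows "em_weight A = w"
proof -
  have n: "0 < n" using sum by (cases n) auto
  have lm: "lambda_max A = m" by (rule lambda_max_eq[OF A a w n])
  have dim: "dim_row A = n" using A by simp
  show ?thesis
    unfolding em_weight_def lm dim
  proof (rule the_equality)
    fix v assume v: "v \<in> carrier_vec n \<and> (\<forall>i<n. 0 < v $ i) \<and> (\<Sum>i<n. v $ i) = 1 \<and>
      A *\<^sub>v v = m \<cdot>\<^sub>v v"
    then obtain c where c: "\<And>j. j < n \<Longrightarrow> v $ j = c * w $ j"
      using positive_eigenvector_unique[where a = "\<lambda>i j. A $$ (i, j)" and u = "($) w"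
          and v = "($) v" and m = m and n = n, OF a w(2) eigen_equation_index[OF A w(1,3)]
          eigen_equation_index[OF A]] by blast
    have "1 = (\<Sum>j<n. c * w $ j)" using v c by simp
    then have "c = 1" by (simp add: sum sum_distrib_left[symmetric])
    then show "v = w" using c v w(1) by (intro eq_vecI) auto
  qed (use w sum in auto)
qed

lemma em_ranking_iff:
  assumes A: "A \<in> carrier_mat n n"
    and a: "\<And>i j. i < n \<Longrightarrow> j < n \<Longrightarrow> 0 < A $$ (i, j)"
    and u: "\<And>i. i < n \<Longrightarrow> 0 < u i"
    and eu: "\<And>i. i < n \<Longrightarrow> (\<Sum>j<n. A $$ (i, j) * u j) = m * u i"
    and ij: "i < n" "j < n"
  shows "em_ranking A i j \<longleftrightarrow> u j \<le> u i"
proof -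
  define s where "s = (\<Sum>i<n. u i)"
  have s: "0 < s" unfolding s_def using ij u by (intro sum_pos) auto
  define w where "w = vec n (\<lambda>i. u i / s)"
  have w: "w \<in> carrier_vec n" by (simp add: w_def)
  have "em_weight A = w"
  proof (rule em_weight_eq[OF A a w])
    show "A *\<^sub>v w = m \<cdot>\<^sub>v w"
    proof (rule eq_vecI)
      fix i assume "i < dim_vec (m \<cdot>\<^sub>v w)"
      then have i: "i < n" by (simp add: w_def)
      have "(A *\<^sub>v w) $ i = (\<Sum>j<n. A $$ (i, j) * u j) / s"
        unfolding mult_mat_vec_index_sum[OF A w i] by (simp add: w_def sum_divide_distrib)
      then show "(A *\<^sub>v w) $ i = (m \<cdot>\<^sub>v w) $ i" using i eu[OF i] by (simp add: w_def)
    qed (use A in \<open>simp add: w_def\<close>)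
    show "(\<Sum>i<n. w $ i) = 1"
      using s by (simp add: w_def sum_divide_distrib[symmetric] s_def[symmetric])
  qed (use u s in \<open>auto simp: w_def\<close>)
  then show ?thesis
    using ij s by (simp add: em_ranking_def w_def divide_le_cancel)
qed

section \<open>At most three alternatives\<close>

lemma pairwise_comparisonD:
  assumes "A \<in> pairwise_comparison_matrices n"
  shows "A \<in> carrier_mat n n"
    and "i < n \<Longrightarrow> j < n \<Longrightarrow> 0 < A $$ (i, j)"
    and "i < n \<Longrightarrow> j < n \<Longrightarrow> A $$ (j, i) = 1 / A $$ (i, j)"
  using assms unfolding pairwise_comparison_matrices_def by blast+

definition row_product :: "nat \<Rightarrow> real mat \<Rightarrow> nat \<Rightarrow> real" where
  "row_product n A i = (\<Prod>j<n. A $$ (i, j))"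

lemma row_product_pos:
  assumes "A \<in> pairwise_comparison_matrices n" "i < n"
  shows "0 < row_product n A i"
  unfolding row_product_def
  using pairwise_comparisonD(2)[OF assms(1)] assms(2) by (intro prod_pos) auto

lemma pairwise_comparison_diag:
  assumes "A \<in> pairwise_comparison_matrices n" "i < n"
  shows "A $$ (i, i) = 1"
proof -
  have "0 < A $$ (i, i)" "A $$ (i, i) = 1 / A $$ (i, i)"
    using pairwise_comparisonD(2,3)[OF assms(1)] assms(2) by blast+
  then have "(A $$ (i, i))\<^sup>2 = 1"
    by (metis less_irrefl nonzero_eq_divide_eq power2_eq_square)
  then show ?thesis using \<open>0 < A $$ (i, i)\<close> by (simp add: power2_eq_1_iff)
qed

lemma sum_lessThan_2: "(\<Sum>j<2. f j) = f 0 + f (1::nat)" for f :: "nat \<Rightarrow> real"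
  by (simp add: eval_nat_numeral)

lemma prod_lessThan_2: "(\<Prod>j<2. f j) = f 0 * f (1::nat)" for f :: "nat \<Rightarrow> real"
  by (simp add: eval_nat_numeral)

lemma sum_lessThan_3: "(\<Sum>j<3. f j) = f 0 + f 1 + f (2::nat)" for f :: "nat \<Rightarrow> real"
  by (simp add: eval_nat_numeral)

lemma prod_lessThan_3: "(\<Prod>j<3. f j) = f 0 * f 1 * f (2::nat)" for f :: "nat \<Rightarrow> real"
  by (simp add: eval_nat_numeral)

text \<open>For \<open>n = 3\<close>, after division of the entries by the ratios of the row means, only the cyclic
  product \<open>t\<^sup>3 = a\<^sub>0\<^sub>1 a\<^sub>1\<^sub>2 a\<^sub>2\<^sub>0\<close> survives: the rows become permutations of \<open>1, t, 1/t\<close>, whence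
  their common sum is the eigenvalue.\<close>

lemma row_geometric_mean_eigenvector:
  assumes A: "A \<in> pairwise_comparison_matrices n" and n: "0 < n" "n \<le> 3"
  shows "\<exists>m. \<forall>i<n. (\<Sum>j<n. A $$ (i, j) * root n (row_product n A j)) =
    m * root n (row_product n A i)"
proof -
  have pos: "0 < A $$ (i, j)" and inv: "A $$ (j, i) = 1 / A $$ (i, j)" if "i < n" "j < n" for i j
    using pairwise_comparisonD(2,3)[OF A] that by blast+
  note diag = pairwise_comparison_diag[OF A]
  consider "n = 1" | "n = 2" | "n = 3" using n by linarith
  then show ?thesis
  proof cases
    case 1
    then show ?thesis by (intro exI[of _ "A $$ (0, 0)"]) auto
  next
    case 2
    define x where "x = sqrt (A $$ (0, 1))"
    have x: "0 < x" using pos[of 0 1] 2 by (simp add: x_def)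
    have e: "A $$ (0, 1) = x\<^sup>2" "A $$ (0, 0) = 1" "A $$ (1, 1) = 1"
      using pos[of 0 1] diag[of 0] diag[of 1] 2 by (simp_all add: x_def)
    have f: "A $$ (1, 0) = 1 / x\<^sup>2" using inv[of 0 1] e 2 by simp
    have "row_product 2 A 0 = x\<^sup>2" "row_product 2 A 1 = (1 / x)\<^sup>2"
      using e f by (simp_all add: row_product_def prod_lessThan_2 power_divide)
    then have r: "root 2 (row_product 2 A 0) = x" "root 2 (row_product 2 A 1) = 1 / x"
      using x by (simp_all add: real_root_power_cancel del: power_divide)
    have "\<forall>i<2. (\<Sum>j<2. A $$ (i, j) * root 2 (row_product 2 A j)) =
        2 * root 2 (row_product 2 A i)"
    proof (intro allI impI)
      fix i :: nat assume "i < 2"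
      then have "i = 0 \<or> i = 1" by auto
      then show "(\<Sum>j<2. A $$ (i, j) * root 2 (row_product 2 A j)) =
        2 * root 2 (row_product 2 A i)"
        unfolding sum_lessThan_2
      proof (elim disjE; hypsubst)
        show "A $$ (0, 0) * root 2 (row_product 2 A 0) + A $$ (0, 1) * root 2 (row_product 2 A 1)
          = 2 * root 2 (row_product 2 A 0)"
          unfolding r e f using x by (simp add: field_simps power2_eq_square)
        show "A $$ (1, 0) * root 2 (row_product 2 A 0) + A $$ (1, 1) * root 2 (row_product 2 A 1)
          = 2 * root 2 (row_product 2 A 1)"
          unfolding r e f using x by (simp add: field_simps power2_eq_square)
      qed
    qed
    then show ?thesis using 2 by blast
  next
    case 3
    define x where "x = root 3 (A $$ (0, 1))"
    define y where "y = root 3 (A $$ (0, 2))"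
    define z where "z = root 3 (A $$ (1, 2))"
    have xyz: "0 < x" "0 < y" "0 < z"
      using pos[of 0 1] pos[of 0 2] pos[of 1 2] 3 by (simp_all add: x_def y_def z_def)
    have e: "A $$ (0, 1) = x ^ 3" "A $$ (0, 2) = y ^ 3" "A $$ (1, 2) = z ^ 3"
      "A $$ (0, 0) = 1" "A $$ (1, 1) = 1" "A $$ (2, 2) = 1"
      using pos[of 0 1] pos[of 0 2] pos[of 1 2] diag[of 0] diag[of 1] diag[of 2] 3
      by (simp_all add: x_def y_def z_def)
    have f: "A $$ (1, 0) = 1 / x ^ 3" "A $$ (2, 0) = 1 / y ^ 3" "A $$ (2, 1) = 1 / z ^ 3"
      using inv[of 0 1] inv[of 0 2] inv[of 1 2] e 3 by simp_all
    have "row_product 3 A 0 = (x * y) ^ 3" "row_product 3 A 1 = (z / x) ^ 3"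
      "row_product 3 A 2 = (1 / (y * z)) ^ 3"
      using e f by (simp_all add: row_product_def prod_lessThan_3 power_mult_distrib power_divide)
    then have r: "root 3 (row_product 3 A 0) = x * y" "root 3 (row_product 3 A 1) = z / x"
      "root 3 (row_product 3 A 2) = 1 / (y * z)"
      using xyz by (simp_all add: real_root_power_cancel del: power_mult_distrib)
    have "\<forall>i<3. (\<Sum>j<3. A $$ (i, j) * root 3 (row_product 3 A j)) =
        (1 + x * z / y + y / (x * z)) * root 3 (row_product 3 A i)"
    proof (intro allI impI)
      fix i :: nat assume "i < 3"
      then have "i = 0 \<or> i = 1 \<or> i = 2" by auto
      then show "(\<Sum>j<3. A $$ (i, j) * root 3 (row_product 3 A j)) =
        (1 + x * z / y + y / (x * z)) * root 3 (row_product 3 A i)"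
        unfolding sum_lessThan_3
      proof (elim disjE; hypsubst)
        show "A $$ (0, 0) * root 3 (row_product 3 A 0) + A $$ (0, 1) * root 3 (row_product 3 A 1)
          + A $$ (0, 2) * root 3 (row_product 3 A 2) =
          (1 + x * z / y + y / (x * z)) * root 3 (row_product 3 A 0)"
          unfolding r e f using xyz by (simp add: field_simps power3_eq_cube)
        show "A $$ (1, 0) * root 3 (row_product 3 A 0) + A $$ (1, 1) * root 3 (row_product 3 A 1)
          + A $$ (1, 2) * root 3 (row_product 3 A 2) =
          (1 + x * z / y + y / (x * z)) * root 3 (row_product 3 A 1)"
          unfolding r e f using xyz by (simp add: field_simps power3_eq_cube)
        show "A $$ (2, 0) * root 3 (row_product 3 A 0) + A $$ (2, 1) * root 3 (row_product 3 A 1)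
          + A $$ (2, 2) * root 3 (row_product 3 A 2) =
          (1 + x * z / y + y / (x * z)) * root 3 (row_product 3 A 2)"
          unfolding r e f using xyz by (simp add: field_simps power3_eq_cube)
      qed
    qed
    then show ?thesis using 3 by blast
  qed
qed

lemma em_ranking_iff_row_product:
  assumes A: "A \<in> pairwise_comparison_matrices n" and n: "n \<le> 3"
    and ij: "i < n" "j < n"
  shows "em_ranking A i j \<longleftrightarrow> row_product n A j \<le> row_product n A i"
proof -
  have n0: "0 < n" using ij by simp
  obtain m where m: "\<And>i. i < n \<Longrightarrow> (\<Sum>j<n. A $$ (i, j) * root n (row_product n A j)) =
      m * root n (row_product n A i)"
    using row_geometric_mean_eigenvector[OF A n0 n] by blast
  have "em_ranking A i j \<longleftrightarrow> root n (row_product n A j) \<le> root n (row_product n A i)"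
    by (rule em_ranking_iff[where n = n and m = m])
      (use pairwise_comparisonD(1,2)[OF A] m ij n0 row_product_pos[OF A] in auto)
  then show ?thesis using n0 by simp
qed

lemma real_root_prod:
  assumes "0 < k"
  shows "root k (prod f S) = (\<Prod>x\<in>S. root k (f x))"
  using assms by (induction S rule: infinite_finite_induct) (auto simp: real_root_mult)

lemma row_product_aggregate:
  assumes "0 < k" "i < n"
  shows "row_product n (aggregate n k A) i = root k (\<Prod>l=1..k. row_product n (A l) i)"
proof -
  have "row_product n (aggregate n k A) i = (\<Prod>j<n. root k (\<Prod>l=1..k. A l $$ (i, j)))"
    using assms(2) by (simp add: row_product_def aggregate_def)
  also have "\<dots> = root k (\<Prod>j<n. \<Prod>l=1..k. A l $$ (i, j))"
    by (simp add: real_root_prod[OF assms(1)])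
  finally show ?thesis unfolding row_product_def by (subst (asm) prod.swap)
qed

lemma prod_strict_mono_ex1:
  fixes f g :: "'a \<Rightarrow> real"
  assumes "finite S" "\<And>x. x \<in> S \<Longrightarrow> 0 < f x \<and> f x \<le> g x" "y \<in> S" "f y < g y"
  shows "prod f S < prod g S"
proof -
  have "f y * prod f (S - {y}) < g y * prod g (S - {y})"
  proof (rule mult_less_le_imp_less)
    show "prod f (S - {y}) \<le> prod g (S - {y})"
      using assms(2) by (intro prod_mono) (auto intro: less_imp_le)
    show "0 < prod f (S - {y})" using assms(2) by (intro prod_pos) auto
  qed (use assms(2)[OF assms(3)] assms(4) in auto)
  then show ?thesis using assms(1,3) by (simp add: prod.remove)
qed

lemma group_coherence_le_3:
  assumes n: "n \<le> 3"
  shows "group_coherence_for_choice n em_ranking"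
  unfolding group_coherence_for_choice_def
proof (intro allI impI)
  fix k :: nat and A i
  assume k: "1 \<le> k" and A: "\<forall>l\<in>{1..k}. A l \<in> pairwise_comparison_matrices n"
    and i: "i < n" and best: "\<forall>l\<in>{1..k}. \<forall>j<n. em_ranking (A l) i j"
  have agg: "aggregate n k A \<in> pairwise_comparison_matrices n"
    using aggregate_pairwise_comparison_matrices[OF k] A by blast
  have k0: "0 < k" using k by simp
  have le: "row_product n (A l) j \<le> row_product n (A l) i" if "j < n" "l \<in> {1..k}" for j l
    using best that A em_ranking_iff_row_product[OF _ n i] by blast
  have pos: "0 < row_product n (A l) j" if "j < n" "l \<in> {1..k}" for j l
    using row_product_pos A that by blast
  have "em_ranking (aggregate n k A) i j" if j: "j < n" for j
  proof -
    have "(\<Prod>l=1..k. row_product n (A l) j) \<le> (\<Prod>l=1..k. row_product n (A l) i)"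
      using le[OF j] pos[OF j] by (intro prod_mono) (auto intro: less_imp_le)
    then show ?thesis
      using em_ranking_iff_row_product[OF agg n i j] k0 i j by (simp add: row_product_aggregate)
  qed
  moreover have "strict_part (em_ranking (aggregate n k A)) i j"
    if ex: "\<exists>l\<in>{1..k}. \<forall>j<n. j \<noteq> i \<longrightarrow> strict_part (em_ranking (A l)) i j"
      and j: "j < n" "j \<noteq> i" for j
  proof -
    obtain l where l: "l \<in> {1..k}" "\<not> em_ranking (A l) j i"
      using ex j unfolding strict_part_def by blast
    then have less: "row_product n (A l) j < row_product n (A l) i"
      using A em_ranking_iff_row_product[OF _ n j(1) i, of "A l"] by auto
    have "(\<Prod>l=1..k. row_product n (A l) j) < (\<Prod>l=1..k. row_product n (A l) i)"
      using le[OF j(1)] pos[OF j(1)] l(1) less by (intro prod_strict_mono_ex1) auto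
    then show ?thesis
      using em_ranking_iff_row_product[OF agg n] k0 i j
      by (simp add: strict_part_def row_product_aggregate)
  qed
  ultimately show "(\<forall>j<n. em_ranking (aggregate n k A) i j) \<and>
    ((\<exists>l\<in>{1..k}. \<forall>j<n. j \<noteq> i \<longrightarrow> strict_part (em_ranking (A l)) i j) \<longrightarrow>
      (\<forall>j<n. j \<noteq> i \<longrightarrow> strict_part (em_ranking (aggregate n k A)) i j))"
    by blast
qed

section \<open>Four alternatives\<close>

text \<open>The list \<open>p\<close> gives the successor of each alternative on the cycle. The value 8 is chosen
  because its powers that occur in the aggregate have rational cube roots.\<close>

definition cycle_matrix :: "nat list \<Rightarrow> real mat" where
  "cycle_matrix p = mat 4 4 (\<lambda>(i, j). if p ! i = j then 8 else if p ! j = i then 1 / 8 else 1)"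

text \<open>The lists encode \<open>0 \<rightarrow> 1 \<rightarrow> 2 \<rightarrow> 3 \<rightarrow> 0\<close>, \<open>0 \<rightarrow> 2 \<rightarrow> 3 \<rightarrow> 1 \<rightarrow> 0\<close> and
  \<open>0 \<rightarrow> 3 \<rightarrow> 1 \<rightarrow> 2 \<rightarrow> 0\<close>, the orbit of the first cycle under the rotation of 1, 2, 3.\<close>

definition cycles :: "nat \<Rightarrow> nat list" where
  "cycles l = (if l = 1 then [1, 2, 3, 0] else if l = 2 then [2, 0, 3, 1] else [3, 2, 0, 1])"

lemma less_4_cases: "(i::nat) < 4 \<Longrightarrow> i = 0 \<or> i = 1 \<or> i = 2 \<or> i = 3"
  by auto

lemma sum_lessThan_4: "(\<Sum>j<4. f j) = f 0 + f 1 + f 2 + f (3::nat)" for f :: "nat \<Rightarrow> real"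
  by (simp add: eval_nat_numeral)

lemma cycle_matrix_pairwise_comparison:
  "cycle_matrix (cycles l) \<in> pairwise_comparison_matrices 4"
proof -
  have "0 < cycle_matrix (cycles l) $$ (i, j) \<and>
      cycle_matrix (cycles l) $$ (j, i) = 1 / cycle_matrix (cycles l) $$ (i, j)"
    if "i < 4" "j < 4" for i j
    using less_4_cases[OF that(1)] less_4_cases[OF that(2)]
    by (elim disjE) (simp_all add: cycle_matrix_def cycles_def)
  moreover have "cycle_matrix (cycles l) \<in> carrier_mat 4 4"
    by (simp add: cycle_matrix_def)
  ultimately show ?thesis
    unfolding pairwise_comparison_matrices_def by blast
qed

lemma cycle_matrix_row_sum:
  assumes "i < 4"
  shows "(\<Sum>j<4. cycle_matrix (cycles l) $$ (i, j)) = 10 + 1 / 8"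
  using less_4_cases[OF assms]
  by (elim disjE) (simp_all add: sum_lessThan_4 cycle_matrix_def cycles_def)

lemma em_ranking_cycle_matrix:
  assumes "i < 4" "j < 4"
  shows "em_ranking (cycle_matrix (cycles l)) i j"
  using em_ranking_iff[where A = "cycle_matrix (cycles l)" and n = 4 and u = "\<lambda>_. 1"
      and m = "10 + 1 / 8" and i = i and j = j]
    pairwise_comparisonD(1,2)[OF cycle_matrix_pairwise_comparison[of l]]
    cycle_matrix_row_sum assms
  by simp

lemma aggregate_cycle_matrix:
  assumes "i < 4" "j < 4"
  shows "aggregate 4 3 (\<lambda>l. cycle_matrix (cycles l)) $$ (i, j) =
    [[1, 1, 1, 1], [1, 1, 4, 1 / 4], [1, 1 / 4, 1, 4], [1, 4, 1 / 4, 1]] ! i ! j"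
proof -
  have r: "root 3 64 = 4"
    using real_root_power_cancel[of 3 4] by simp
  have p: "(\<Prod>l=Suc 0..3. f l) = f 1 * f 2 * f (3::nat)" for f :: "nat \<Rightarrow> real"
    by (simp add: eval_nat_numeral)
  show ?thesis
    using less_4_cases[OF assms(1)] less_4_cases[OF assms(2)]
    by (elim disjE)
      (simp_all add: aggregate_def p cycle_matrix_def cycles_def real_root_divide r)
qed

lemma not_group_coherence_4: "\<not> group_coherence_for_choice 4 em_ranking"
proof
  define A where "A = (\<lambda>l. cycle_matrix (cycles l))"
  define B where "B = aggregate 4 3 A"
  assume "group_coherence_for_choice 4 em_ranking"
  then have best: "em_ranking B 0 1"
    using cycle_matrix_pairwise_comparison em_ranking_cycle_matrix
    unfolding group_coherence_for_choice_def B_def A_def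
    by (elim allE[of _ "3::nat"] allE[of _ "\<lambda>l. cycle_matrix (cycles l)"]) force
  have B: "B \<in> pairwise_comparison_matrices 4"
    unfolding B_def A_def
    by (intro aggregate_pairwise_comparison_matrices cycle_matrix_pairwise_comparison) simp
  (* For (1, y, y, y), row 0 gives the eigenvalue 1 + 3 y, and each of the other rows
     requires 1 + (1 + 4 + 1/4) y = (1 + 3 y) y; y is the positive root. *)
  define y where "y = (17 + sqrt 481) / (24::real)"
  have "24 * y - 17 = sqrt 481" by (simp add: y_def field_simps)
  then have "(24 * y - 17)\<^sup>2 = 481" by simp
  then have y: "3 * y * y = 17 / 4 * y + 1" by (simp add: power2_eq_square algebra_simps)
  have "7 < sqrt (481::real)" by (simp add: real_less_rsqrt)
  then have y1: "1 < y" by (simp add: y_def)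
  define u :: "nat \<Rightarrow> real" where "u = (\<lambda>i. if i = 0 then 1 else y)"
  have eu: "(\<Sum>j<4. B $$ (i, j) * u j) = (1 + 3 * y) * u i" if "i < 4" for i
    using less_4_cases[OF that] y
    by (elim disjE)
      (simp_all add: sum_lessThan_4 B_def A_def aggregate_cycle_matrix u_def algebra_simps)
  have "em_ranking B 0 1 \<longleftrightarrow> u 1 \<le> u 0"
    by (rule em_ranking_iff[where n = 4 and m = "1 + 3 * y"])
      (use pairwise_comparisonD(1,2)[OF B] eu y1 in \<open>auto simp: u_def\<close>)
  then show False using best y1 by (simp add: u_def)
qed

section \<open>The minimal number of alternatives\<close>

theorem mainTheorem2:
  shows "\<not> group_coherence_for_choice 4 em_ranking \<and>
    (\<forall>n\<le>3. group_coherence_for_choice n em_ranking)"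
  using not_group_coherence_4 group_coherence_le_3 by blast

end
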